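(* A graph $G=(V,E)$ has an antistrong orientation if and only if $$e(\mathcal Q)\ge |\mathcal Q|-1+b(\mathcal Q)$$ for all partitions $\mathcal Q$ of $V$, where $e(\mathcal Q)$ denotes the number of edges of $G$ joining vertices in different parts of $\mathcal Q$ and $b(\mathcal Q)$ denotes the number of parts $X\in\mathcal Q$ for which the induced subgraph $G[X]$ is bipartite.
   Context: Graphs are finite and loopless; parallel edges may occur. A single vertex induces a bipartite subgraph. An orientation of $G$ replaces each edge by an arc joining its ends. In a walk (in the underlying graph) of a digraph an arc $vw$ is forward if traversed from $v$ to $w$ and backward if traversed from $w$ to $v$. An antidirected trail is a walk with no repeated arc whose arcs alternate between forward and backward; it is a forward antidirected trail if it begins and ends with a forward arc. A digraph is antistrong if it has at least three vertices and contains a forward antidirected $(x,y)$-trail for every pair of distinct vertices $x,y$. *)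

theory Defs
  imports "Graph_Theory.Digraph" "HOL-Library.Disjoint_Sets"
begin

text \<open>
  Undirected multigraphs: every edge is a named object with a set of end vertices, so that
  parallel edges are distinct edges with equal sets of ends.
\<close>

record ('v, 'e) multigraph =
  gverts :: "'v set"
  gedges :: "'e set"
  ends :: "'e \<Rightarrow> 'v set"

text \<open>
  Finite loopless graphs. As usual the vertex set is nonempty; for the null graph the
  characterisation fails, its only partition being the empty one, which satisfies the
  inequality \<open>0 \<ge> 0 - 1 + 0\<close>.
\<close>

locale fin_loopless_multigraph =
  fixes G :: "('v, 'e) multigraph"
  assumes finite_gverts: "finite (gverts G)"
    and finite_gedges: "finite (gedges G)"
    and gverts_nonempty: "gverts G \<noteq> {}"
    and ends_in_gverts: "e \<in> gedges G \<Longrightarrow> ends G e \<subseteq> gverts G"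
    and two_ends: "e \<in> gedges G \<Longrightarrow> card (ends G e) = 2"

definition induced :: "('v, 'e) multigraph \<Rightarrow> 'v set \<Rightarrow> ('v, 'e) multigraph" where
  "induced G X = \<lparr>gverts = X, gedges = {e \<in> gedges G. ends G e \<subseteq> X}, ends = ends G\<rparr>"

text \<open>Colour classes may be empty, so a single vertex is bipartite.\<close>

definition bipartite :: "('v, 'e) multigraph \<Rightarrow> bool" where
  "bipartite G \<longleftrightarrow> (\<exists>A B. A \<union> B = gverts G \<and> A \<inter> B = {} \<and>
     (\<forall>e\<in>gedges G. \<exists>a\<in>A. \<exists>b\<in>B. ends G e = {a, b}))"

definition cross_edges :: "('v, 'e) multigraph \<Rightarrow> 'v set set \<Rightarrow> 'e set" where
  "cross_edges G Q = {e \<in> gedges G. \<exists>X\<in>Q. \<exists>Y\<in>Q. X \<noteq> Y \<and> (\<exists>x\<in>X. \<exists>y\<in>Y. ends G e = {x, y})}"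

definition bipartite_parts :: "('v, 'e) multigraph \<Rightarrow> 'v set set \<Rightarrow> 'v set set" where
  "bipartite_parts G Q = {X \<in> Q. bipartite (induced G X)}"

definition orientation_of :: "('v, 'e) pre_digraph \<Rightarrow> ('v, 'e) multigraph \<Rightarrow> bool" where
  "orientation_of D G \<longleftrightarrow> verts D = gverts G \<and> arcs D = gedges G \<and>
     (\<forall>e\<in>gedges G. {tail D e, head D e} = ends G e)"

text \<open>
  A walk in the underlying graph of a digraph is given by the sequence of traversed arcs
  together with the direction in which each of them is traversed.
\<close>

datatype direction = Forward | Backward

fun step_source :: "('v, 'e) pre_digraph \<Rightarrow> 'e \<times> direction \<Rightarrow> 'v" where
  "step_source D (e, Forward) = tail D e"
| "step_source D (e, Backward) = head D e"

fun step_target :: "('v, 'e) pre_digraph \<Rightarrow> 'e \<times> direction \<Rightarrow> 'v" where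
  "step_target D (e, Forward) = head D e"
| "step_target D (e, Backward) = tail D e"

fun underlying_walk :: "('v, 'e) pre_digraph \<Rightarrow> 'v \<Rightarrow> ('e \<times> direction) list \<Rightarrow> 'v \<Rightarrow> bool" where
  "underlying_walk D x [] y \<longleftrightarrow> x \<in> verts D \<and> x = y"
| "underlying_walk D x (s # p) y \<longleftrightarrow>
     fst s \<in> arcs D \<and> step_source D s = x \<and> underlying_walk D (step_target D s) p y"

definition antidirected_trail ::
    "('v, 'e) pre_digraph \<Rightarrow> 'v \<Rightarrow> ('e \<times> direction) list \<Rightarrow> 'v \<Rightarrow> bool" where
  "antidirected_trail D x p y \<longleftrightarrow> underlying_walk D x p y \<and> distinct (map fst p) \<and>
     successively (\<lambda>s t. snd s \<noteq> snd t) p"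

definition forward_antidirected_trail ::
    "('v, 'e) pre_digraph \<Rightarrow> 'v \<Rightarrow> ('e \<times> direction) list \<Rightarrow> 'v \<Rightarrow> bool" where
  "forward_antidirected_trail D x p y \<longleftrightarrow> antidirected_trail D x p y \<and>
     p \<noteq> [] \<and> snd (hd p) = Forward \<and> snd (last p) = Forward"

definition antistrong :: "('v, 'e) pre_digraph \<Rightarrow> bool" where
  "antistrong D \<longleftrightarrow> card (verts D) \<ge> 3 \<and>
     (\<forall>x\<in>verts D. \<forall>y\<in>verts D. x \<noteq> y \<longrightarrow> (\<exists>p. forward_antidirected_trail D x p y))"

end

theory Submission
  imports Defs
begin

text \<open>
  For at least three vertices, a digraph is antistrong iff its bipartite representation, with an
  edge between the out-copy of \<open>u\<close> and the in-copy of \<open>v\<close> for every arc \<open>uv\<close>, is connected. An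
  orientation therefore chooses, for every edge \<open>uv\<close> of \<open>G\<close>, one of the two edges lying over it in the
  bipartite double cover of \<open>G\<close>, and a connected choice is wanted. Rado's theorem for the graphic
  matroid says that it exists iff for every edge set \<open>F\<close> the number of components of the double
  cover of \<open>F\<close> exceeds the number of edges outside \<open>F\<close> by at most 1. A component of \<open>F\<close> lifts
  to two components of the double cover if it is bipartite and to one otherwise, which gives the
  partition condition.
\<close>

section \<open>Rado's theorem\<close>

text \<open>The sets \<open>A e\<close> are shrunk until all are singletons and the choice is
  forced. If neither \<open>x\<close> nor \<open>y\<close> can be deleted from \<open>A e\<close>,
  the two violating edge sets are uncrossed by submodularity. Rado's usual condition is the case
  \<open>k = card E\<close>; smaller \<open>k\<close> allows a defect.\<close>

lemma rado_defect:
  fixes r :: "'x set \<Rightarrow> int" and A :: "'e \<Rightarrow> 'x set"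
  assumes mono: "\<And>X Y. X \<subseteq> Y \<Longrightarrow> Y \<subseteq> S \<Longrightarrow> r X \<le> r Y"
    and submod: "\<And>X Y. X \<subseteq> S \<Longrightarrow> Y \<subseteq> S \<Longrightarrow> r (X \<union> Y) + r (X \<inter> Y) \<le> r X + r Y"
    and fin: "finite E"
    and A: "\<And>e. e \<in> E \<Longrightarrow> finite (A e) \<and> A e \<noteq> {} \<and> A e \<subseteq> S"
    and cond: "\<And>F. F \<subseteq> E \<Longrightarrow> k \<le> int (card (E - F)) + r (\<Union>(A ` F))"
  shows "\<exists>f. (\<forall>e\<in>E. f e \<in> A e) \<and> k \<le> r (f ` E)"
  using A cond
proof (induction "\<Sum>e\<in>E. card (A e)" arbitrary: A rule: less_induct)
  case less
  show ?case
  proof (cases "\<exists>e\<in>E. \<exists>x\<in>A e. \<exists>y\<in>A e. x \<noteq> y")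
    case False
    define f where "f e = (SOME x. x \<in> A e)" for e
    have f: "A e = {f e}" if "e \<in> E" for e
    proof -
      have "f e \<in> A e" using less.prems(1)[OF that] unfolding f_def by (simp add: some_in_eq)
      then show ?thesis using False that by blast
    qed
    have "\<Union>(A ` E) = f ` E" using f by auto
    with less.prems(2)[of E] have "k \<le> r (f ` E)" by simp
    then show ?thesis using f by blast
  next
    case True
    then obtain e x y where e: "e \<in> E" and xy: "x \<in> A e" "y \<in> A e" "x \<noteq> y" by blast
    define B where "B z = A(e := A e - {z})" for z
    have B: "finite (B z e') \<and> B z e' \<noteq> {} \<and> B z e' \<subseteq> S" if "z = x \<or> z = y" "e' \<in> E" for z e'
      using less.prems(1)[OF that(2)] that(1) xy unfolding B_def by auto
    have smaller: "(\<Sum>e\<in>E. card (B z e)) < (\<Sum>e\<in>E. card (A e))" if "z = x \<or> z = y" for z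
    proof (rule sum_strict_mono_ex1[OF fin])
      show "\<forall>e\<in>E. card (B z e) \<le> card (A e)"
        unfolding B_def using less.prems(1) by (auto intro: card_mono)
      show "\<exists>e\<in>E. card (B z e) < card (A e)"
        using e that xy less.prems(1)[OF e] unfolding B_def
        by (intro bexI[of _ e]) (auto intro: card_Diff1_less)
    qed
    show ?thesis
    proof (cases "\<exists>z. (z = x \<or> z = y) \<and> (\<forall>F\<subseteq>E. k \<le> int (card (E - F)) + r (\<Union>(B z ` F)))")
      case True
      then obtain z where z: "z = x \<or> z = y"
        and condz: "\<And>F. F \<subseteq> E \<Longrightarrow> k \<le> int (card (E - F)) + r (\<Union>(B z ` F))" by blast
      have "\<exists>f. (\<forall>e\<in>E. f e \<in> B z e) \<and> k \<le> r (f ` E)"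
        by (rule less.hyps[OF smaller[OF z]]) (use B z condz in blast)+
      moreover have "B z e' \<subseteq> A e'" for e' unfolding B_def by auto
      ultimately show ?thesis by blast
    next
      case False
      have "\<exists>F\<subseteq>E. e \<in> F \<and> int (card (E - F)) + r (\<Union>(B z ` F)) < k" if z: "z = x \<or> z = y" for z
      proof -
        obtain F where F: "F \<subseteq> E" "int (card (E - F)) + r (\<Union>(B z ` F)) < k"
          using False z not_le by metis
        moreover have "e \<in> F"
        proof (rule ccontr)
          assume "e \<notin> F"
          then have "B z ` F = A ` F" unfolding B_def by auto
          then show False using less.prems(2)[OF F(1)] F(2) by simp
        qed
        ultimately show ?thesis by blast
      qed
      then obtain F1 F2 where F1: "F1 \<subseteq> E" "e \<in> F1" "int (card (E - F1)) + r (\<Union>(B x ` F1)) < k"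
        and F2: "F2 \<subseteq> E" "e \<in> F2" "int (card (E - F2)) + r (\<Union>(B y ` F2)) < k"
        by metis
      \<comment> \<open>The deleted elements differ, so the union of the two reduced families
        restores all of \<open>A e\<close>; their intersection may miss part of it, hence
        \<open>e\<close> is left out of \<open>?I\<close>.\<close>
      let ?X = "\<Union>(B x ` F1)" and ?Y = "\<Union>(B y ` F2)" and ?I = "F1 \<inter> F2 - {e}"
      have sub: "?X \<subseteq> S" "?Y \<subseteq> S"
        using B F1(1) F2(1) by blast+
      have union: "\<Union>(A ` (F1 \<union> F2)) \<subseteq> ?X \<union> ?Y"
        using F1(2) F2(2) xy(3) unfolding B_def by (auto split: if_splits)
      have inter: "\<Union>(A ` ?I) \<subseteq> ?X \<inter> ?Y"
        unfolding B_def by auto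
      have "r (\<Union>(A ` (F1 \<union> F2))) \<le> r (?X \<union> ?Y)" "r (\<Union>(A ` ?I)) \<le> r (?X \<inter> ?Y)"
        using mono[OF union] mono[OF inter] sub by blast+
      moreover have "r (?X \<union> ?Y) + r (?X \<inter> ?Y) \<le> r ?X + r ?Y"
        using submod sub by blast
      moreover have "k \<le> int (card (E - (F1 \<union> F2))) + r (\<Union>(A ` (F1 \<union> F2)))"
        "k \<le> int (card (E - ?I)) + r (\<Union>(A ` ?I))"
        using F1(1) F2(1) by (intro less.prems(2); blast)+
      \<comment> \<open>Leaving out \<open>e\<close> costs exactly 1. Both violations are strict and
        integral, so they fall short by at least 2 in total, which the extra 1 cannot make
        up.\<close>
      moreover have "card (E - (F1 \<union> F2)) + card (E - ?I) = card (E - F1) + card (E - F2) + 1"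
      proof -
        have I: "E - ?I = insert e ((E - F1) \<union> (E - F2))" using e by auto
        have "card (E - ?I) = Suc (card ((E - F1) \<union> (E - F2)))"
          unfolding I using F1(2) F2(2) fin by simp
        moreover have "card (E - F1) + card (E - F2)
            = card ((E - F1) \<union> (E - F2)) + card ((E - F1) \<inter> (E - F2))"
          using fin by (intro card_Un_Int) auto
        moreover have "(E - F1) \<inter> (E - F2) = E - (F1 \<union> F2)" by auto
        ultimately show ?thesis by simp
      qed
      ultimately have False using F1(3) F2(3) by linarith
      then show ?thesis ..
    qed
  qed
qed

section \<open>Counting connected components\<close>

definition conn :: "'a rel \<Rightarrow> 'a rel" where
  "conn X = (X \<union> X\<inverse>)\<^sup>*"

text \<open>Pairs in \<open>X\<close> serve as undirected edges. The relation \<open>conn X\<close>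
  lives on the whole type, so these are the components that meet \<open>W\<close>, and
  \<open>W\<close> may later be cut down to one part of a partition.\<close>

definition comps :: "'a set \<Rightarrow> 'a rel \<Rightarrow> 'a set set" where
  "comps W X = W // conn X"

lemma equiv_conn: "equiv UNIV (conn X)"
  unfolding conn_def
  by (intro equivI refl_rtrancl trans_rtrancl sym_rtrancl sym_Un_converse) auto

lemma conn_refl [simp]: "(x, x) \<in> conn X"
  unfolding conn_def by simp

lemma conn_sym: "(x, y) \<in> conn X \<Longrightarrow> (y, x) \<in> conn X"
  using equiv_conn[of X] by (meson equivE symD)

lemma conn_trans [trans]: "(x, y) \<in> conn X \<Longrightarrow> (y, z) \<in> conn X \<Longrightarrow> (x, z) \<in> conn X"
  unfolding conn_def by (rule rtrancl_trans)

lemma conn_base: "(x, y) \<in> X \<Longrightarrow> (x, y) \<in> conn X"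
  unfolding conn_def by blast

lemma conn_mono: "X \<subseteq> Y \<Longrightarrow> conn X \<subseteq> conn Y"
  unfolding conn_def by (intro rtrancl_mono) auto

lemma conn_induct [consumes 1, case_names refl edge converse_edge]:
  assumes "(x, y) \<in> conn X" "P x"
    "\<And>y z. (x, y) \<in> conn X \<Longrightarrow> (y, z) \<in> X \<Longrightarrow> P y \<Longrightarrow> P z"
    "\<And>y z. (x, y) \<in> conn X \<Longrightarrow> (z, y) \<in> X \<Longrightarrow> P y \<Longrightarrow> P z"
  shows "P y"
  using assms(1) unfolding conn_def
  by (induction rule: rtrancl_induct) (use assms(2-4) in \<open>auto simp: conn_def\<close>)

lemma conn_closed:
  assumes "(x, y) \<in> conn X" "x \<in> W" "X \<subseteq> W \<times> W"
  shows "y \<in> W"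
  using assms by (induction rule: conn_induct) auto

text \<open>A path has to use the new edge at most once, in one of its two directions.\<close>

lemma conn_insert:
  "conn (insert (a, b) X) = conn X \<union>
     {(x, y). (x, a) \<in> conn X \<and> (b, y) \<in> conn X \<or> (x, b) \<in> conn X \<and> (a, y) \<in> conn X}"
    (is "_ = ?R")
proof
  show "conn (insert (a, b) X) \<subseteq> ?R"
  proof (rule subrelI)
    fix x y assume "(x, y) \<in> conn (insert (a, b) X)"
    then show "(x, y) \<in> ?R"
    proof (induction rule: conn_induct)
      case (edge y z)
      then have "(y, z) = (a, b) \<or> (y, z) \<in> conn X" by (auto dest: conn_base)
      with edge.IH show ?case by (auto intro: conn_trans)
    next
      case (converse_edge y z)
      then have "(z, y) = (a, b) \<or> (y, z) \<in> conn X" by (auto dest: conn_base conn_sym)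
      with converse_edge.IH show ?case by (auto intro: conn_trans)
    qed simp
  qed
  have "conn X \<subseteq> conn (insert (a, b) X)" by (rule conn_mono) auto
  moreover have "(a, b) \<in> conn (insert (a, b) X)" "(b, a) \<in> conn (insert (a, b) X)"
    by (auto intro: conn_base conn_sym)
  ultimately show "?R \<subseteq> conn (insert (a, b) X)"
    by (auto intro: conn_trans)
qed

section \<open>The number of components as a function of the edge set\<close>

lemma comps_eq_image: "comps W X = (\<lambda>x. conn X `` {x}) ` W"
  unfolding comps_def quotient_def by auto

lemma finite_comps [simp]: "finite W \<Longrightarrow> finite (comps W X)"
  by (simp add: comps_eq_image)

lemma conn_class_eq_iff: "conn X `` {x} = conn X `` {y} \<longleftrightarrow> (x, y) \<in> conn X"
  using equiv_class_eq_iff[OF equiv_conn, of x y X] by auto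

text \<open>A new edge either stays within one class or merges exactly two. All later estimates add
  edges one at a time and use this exact count.\<close>

lemma card_comps_insert:
  assumes W: "finite W" "a \<in> W" "b \<in> W"
  shows "card (comps W X) = card (comps W (insert (a, b) X)) + (if (a, b) \<in> conn X then 0 else 1)"
proof (cases "(a, b) \<in> conn X")
  case True
  then have "conn (insert (a, b) X) = conn X"
    unfolding conn_insert by (auto intro: conn_trans dest: conn_sym)
  then show ?thesis using True by (simp add: comps_def)
next
  case False
  let ?A = "conn X `` {a}" and ?B = "conn X `` {b}"
  have ne: "?A \<noteq> ?B" using False by (simp add: conn_class_eq_iff)
  have class_eq: "conn (insert (a, b) X) `` {x}
      = (if conn X `` {x} \<in> {?A, ?B} then ?A \<union> ?B else conn X `` {x})" for x
    unfolding conn_insert insert_iff conn_class_eq_iff empty_iff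
    by (auto intro: conn_trans conn_sym)
  have "comps W (insert (a, b) X) = insert (?A \<union> ?B) (comps W X - {?A, ?B})"
    unfolding comps_eq_image class_eq using W(2) by (auto simp: image_iff)
  \<comment> \<open>The merged class is new, so inserting it into the remaining old classes does
    raise the cardinality.\<close>
  moreover have "?A \<union> ?B \<notin> comps W X"
  proof
    assume "?A \<union> ?B \<in> comps W X"
    then obtain x where x: "?A \<union> ?B = conn X `` {x}" unfolding comps_eq_image by blast
    have "a \<in> ?A \<union> ?B" "b \<in> ?A \<union> ?B" by simp_all
    then have "(x, a) \<in> conn X" "(x, b) \<in> conn X" unfolding x by simp_all
    then show False using False by (meson conn_sym conn_trans)
  qed
  moreover have "card (comps W X) = Suc (Suc (card (comps W X - {?A, ?B})))"
  proof -
    have "comps W X = insert ?A (insert ?B (comps W X - {?A, ?B}))"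
      using W(2,3) unfolding comps_eq_image by auto
    then have "card (comps W X) = card (insert ?A (insert ?B (comps W X - {?A, ?B})))"
      by (rule arg_cong)
    then show ?thesis using W(1) ne by simp
  qed
  ultimately show ?thesis using W(1) False by simp
qed

lemma card_comps_Un_bounds:
  assumes "finite W" "finite Z" "Z \<subseteq> W \<times> W"
  shows "card (comps W (X \<union> Z)) \<le> card (comps W X) \<and>
    card (comps W X) \<le> card (comps W (X \<union> Z)) + card Z"
  using assms(2,3)
proof (induction Z rule: finite_induct)
  case (insert z Z)
  obtain a b where z: "z = (a, b)" by (cases z)
  then have "a \<in> W" "b \<in> W" using insert.prems by auto
  from insert card_comps_insert[OF assms(1) this, of "X \<union> Z"] show ?case
    by (auto simp: z split: if_splits)
qed auto

lemma card_comps_antimono: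
  assumes "finite W" "X \<subseteq> Y" "Y \<subseteq> W \<times> W"
  shows "card (comps W Y) \<le> card (comps W X)"
proof -
  have "finite Y" using assms(1,3) finite_subset by blast
  then show ?thesis
    using card_comps_Un_bounds[OF assms(1) _ assms(3), of X] assms(2) by (simp add: Un_absorb1)
qed

text \<open>Diminishing returns: an edge that merges two components of the larger graph also merges
  two components of the smaller one.\<close>

lemma card_comps_diminishing:
  assumes "finite W" "X \<subseteq> Y" "finite Z" "Z \<subseteq> W \<times> W"
  shows "card (comps W Y) + card (comps W (X \<union> Z)) \<le> card (comps W X) + card (comps W (Y \<union> Z))"
  using assms(3,4)
proof (induction Z rule: finite_induct)
  case (insert z Z)
  obtain a b where z: "z = (a, b)" by (cases z)
  then have ab: "a \<in> W" "b \<in> W" using insert.prems by auto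
  have "conn (X \<union> Z) \<subseteq> conn (Y \<union> Z)" using assms(2) by (intro conn_mono) auto
  then show ?case
    using insert card_comps_insert[OF assms(1) ab, of "X \<union> Z"]
      card_comps_insert[OF assms(1) ab, of "Y \<union> Z"] z
    by (auto split: if_splits)
qed auto

text \<open>Diminishing returns on adding \<open>X\<close> to \<open>X \<inter> Y\<close> and to
  \<open>Y\<close>. Up to the constant \<open>card W\<close>, the negated count is the rank of the
  graphic matroid, so this is the submodularity that Rado's theorem asks for.\<close>

lemma card_comps_supermodular:
  assumes "finite W" "X \<subseteq> W \<times> W" "Y \<subseteq> W \<times> W"
  shows "card (comps W X) + card (comps W Y) \<le> card (comps W (X \<union> Y)) + card (comps W (X \<inter> Y))"
proof -
  have "finite X" using assms(1,2) finite_subset by blast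
  have "X \<inter> Y \<union> X = X" "Y \<union> X = X \<union> Y" by auto
  then show ?thesis
    using card_comps_diminishing[OF assms(1) _ \<open>finite X\<close> assms(2), of "X \<inter> Y" Y] by simp
qed

text \<open>A label that agrees along edges is constant on components, so different labels witness
  different components.\<close>

lemma card_comps_ge_image:
  assumes "finite W" and label: "\<And>x y. (x, y) \<in> X \<Longrightarrow> l x = l y"
  shows "card (l ` W) \<le> card (comps W X)"
proof -
  have const: "l x = l y" if "(x, y) \<in> conn X" for x y
    using that by (induction rule: conn_induct) (auto dest: label)
  have "l ` W \<subseteq> (\<lambda>C. l (SOME x. x \<in> C)) ` comps W X"
  proof
    fix t assume "t \<in> l ` W"
    then obtain x where x: "x \<in> W" "t = l x" by auto
    have "(SOME z. z \<in> conn X `` {x}) \<in> conn X `` {x}" by (rule someI[of _ x]) simp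
    then have "t = l (SOME z. z \<in> conn X `` {x})" using const x(2) by auto
    moreover have "conn X `` {x} \<in> comps W X" using x(1) by (auto simp: comps_eq_image)
    ultimately show "t \<in> (\<lambda>C. l (SOME x. x \<in> C)) ` comps W X" by blast
  qed
  then show ?thesis using assms(1) by (meson finite_comps finite_imageI card_image_le card_mono le_trans)
qed

lemma card_comps_le_1_iff:
  assumes "finite W"
  shows "card (comps W X) \<le> 1 \<longleftrightarrow> W \<times> W \<subseteq> conn X"
proof -
  have "card (comps W X) \<le> 1 \<longleftrightarrow> (\<forall>x\<in>W. \<forall>y\<in>W. conn X `` {x} = conn X `` {y})"
    using card_le_Suc0_iff_eq[OF finite_comps[OF assms, of X]] by (auto simp: comps_eq_image)
  then show ?thesis unfolding conn_class_eq_iff by blast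
qed

lemma partition_on_comps:
  assumes "X \<subseteq> W \<times> W"
  shows "partition_on W (comps W X)"
proof (rule partition_onI)
  show "\<Union>(comps W X) = W"
    using assms by (auto simp: comps_eq_image intro: conn_closed)
  show "disjnt p q" if pq: "p \<in> comps W X" "q \<in> comps W X" "p \<noteq> q" for p q
  proof -
    obtain x y where xy: "p = conn X `` {x}" "q = conn X `` {y}"
      using pq by (auto simp: comps_eq_image)
    then have "(x, y) \<notin> conn X" using pq(3) by (simp add: conn_class_eq_iff)
    then show ?thesis unfolding xy disjnt_iff by (auto intro: conn_trans dest: conn_sym)
  qed
  show "{} \<notin> comps W X"
    by (auto simp: comps_eq_image) (metis Image_singleton_iff conn_refl empty_iff)
qed

section \<open>Antidirected trails as walks in a bipartite graph\<close>

lemma UNIV_direction: "UNIV = {Forward, Backward}"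
  using direction.exhaust by auto

text \<open>Makes the vertex set \<open>gverts G \<times> UNIV\<close> of the double cover
  finite.\<close>

instance direction :: finite
  by standard (simp add: UNIV_direction)

fun opposite :: "direction \<Rightarrow> direction" where
  "opposite Forward = Backward"
| "opposite Backward = Forward"

lemma opposite_opposite [simp]: "opposite (opposite d) = d"
  by (cases d) auto

lemma neq_iff_opposite: "d \<noteq> d' \<longleftrightarrow> d' = opposite d"
  by (cases d; cases d') auto

text \<open>
  A state \<open>(v, d)\<close> records the current vertex together with the direction in which the next
  arc has to be traversed. The states are the vertices of the bipartite representation of the
  digraph: an arc from \<open>u\<close> to \<open>v\<close> joins the out-copy \<open>(u, Forward)\<close> to the in-copy \<open>(v, Backward)\<close>.
\<close>

definition arc_edge :: "('v, 'e) pre_digraph \<Rightarrow> 'e \<Rightarrow> ('v \<times> direction) \<times> ('v \<times> direction)" where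
  "arc_edge D e = ((tail D e, Forward), (head D e, Backward))"

text \<open>Alternation is enforced by the states, so walks can be concatenated whenever the states
  match; arcs may still repeat.\<close>

fun alternating_walk :: "('v, 'e) pre_digraph \<Rightarrow> 'v \<times> direction \<Rightarrow> ('e \<times> direction) list \<Rightarrow>
    'v \<times> direction \<Rightarrow> bool" where
  "alternating_walk D s [] t \<longleftrightarrow> s = t"
| "alternating_walk D s (a # p) t \<longleftrightarrow> fst a \<in> arcs D \<and> s = (step_source D a, snd a) \<and>
     alternating_walk D (step_target D a, opposite (snd a)) p t"

lemma alternating_walk_append:
  "alternating_walk D s (p @ q) t \<longleftrightarrow> (\<exists>m. alternating_walk D s p m \<and> alternating_walk D m q t)"
  by (induction p arbitrary: s) auto

lemma alternating_walk_imp_conn: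
  "alternating_walk D s p t \<Longrightarrow> (s, t) \<in> conn (arc_edge D ` arcs D)"
proof (induction p arbitrary: s)
  case (Cons a p)
  obtain e d where a: "a = (e, d)" by (cases a)
  have "e \<in> arcs D" using Cons.prems a by simp
  then have "arc_edge D e \<in> arc_edge D ` arcs D" by (rule imageI)
  then have edge: "((tail D e, Forward), (head D e, Backward)) \<in> conn (arc_edge D ` arcs D)"
    by (intro conn_base) (simp only: arc_edge_def)
  have "(s, (step_target D a, opposite d)) \<in> conn (arc_edge D ` arcs D)"
    using Cons.prems a edge conn_sym[OF edge] by (cases d) simp_all
  moreover have "((step_target D a, opposite d), t) \<in> conn (arc_edge D ` arcs D)"
    using Cons.prems a by (intro Cons.IH) simp
  ultimately show ?case by (rule conn_trans)
qed simp

lemma conn_imp_alternating_walk: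
  assumes "(s, t) \<in> conn (arc_edge D ` arcs D)"
  shows "\<exists>p. alternating_walk D s p t"
  using assms
proof (induction rule: conn_induct)
  case refl
  show ?case by (intro exI[of _ "[]"]) simp
next
  case (edge y z)
  then obtain p e where "alternating_walk D s p y" "e \<in> arcs D" "(y, z) = arc_edge D e" by auto
  then have "alternating_walk D s (p @ [(e, Forward)]) z"
    by (auto simp: alternating_walk_append arc_edge_def)
  then show ?case by blast
next
  case (converse_edge y z)
  then obtain p e where "alternating_walk D s p y" "e \<in> arcs D" "(z, y) = arc_edge D e" by auto
  then have "alternating_walk D s (p @ [(e, Backward)]) z"
    by (auto simp: alternating_walk_append arc_edge_def)
  then show ?case by blast
qed

text \<open>A shortest walk repeats no arc.\<close>

lemma alternating_walk_distinct:
  assumes "alternating_walk D s p t"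
  shows "\<exists>p. alternating_walk D s p t \<and> distinct (map fst p)"
  using assms
proof (induction p rule: length_induct)
  case (1 p)
  show ?case
  proof (cases "distinct (map fst p)")
    case False
    then obtain es fs gs e where "map fst p = es @ [e] @ fs @ [e] @ gs"
      using not_distinct_decomp by blast
    then obtain q r u d d' where p: "p = q @ (e, d) # r @ (e, d') # u"
      by (fastforce simp: map_eq_append_conv map_eq_Cons_conv append_eq_map_conv Cons_eq_map_conv)
    \<comment> \<open>If \<open>e\<close> is traversed twice in the same direction, both traversals
      end in the same state and a single one suffices. In opposite directions the second returns to
      the state before the first, so the whole closed section is dropped.\<close>
    have "\<exists>p'. length p' < length p \<and> alternating_walk D s p' t"
    proof (cases "d = d'")
      case True
      then have "alternating_walk D s (q @ (e, d) # u) t"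
        using 1(2) p by (auto simp: alternating_walk_append)
      then show ?thesis using p by (intro exI[of _ "q @ (e, d) # u"]) auto
    next
      case False
      then have "alternating_walk D s (q @ u) t"
        using 1(2) p by (cases d; cases d') (auto simp: alternating_walk_append)
      then show ?thesis using p by (intro exI[of _ "q @ u"]) auto
    qed
    then show ?thesis using 1(1) by blast
  qed (use 1 in blast)
qed

text \<open>A final state \<open>(y, d')\<close> expects a further step in direction
  \<open>d'\<close>, so the last step went the opposite way. Forward trails from \<open>x\<close> to
  \<open>y\<close> thus run from \<open>(x, Forward)\<close> to
  \<open>(y, Backward)\<close>.\<close>

lemma alternating_walk_imp_underlying_walk:
  assumes "\<And>e. e \<in> arcs D \<Longrightarrow> tail D e \<in> verts D \<and> head D e \<in> verts D"
    and "alternating_walk D (x, d) p (y, d')" "x \<in> verts D"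
  shows "underlying_walk D x p y \<and> successively (\<lambda>s t. snd s \<noteq> snd t) p \<and>
    (p \<noteq> [] \<longrightarrow> snd (hd p) = d \<and> snd (last p) = opposite d')"
  using assms(2,3)
proof (induction p arbitrary: x d)
  case (Cons a p)
  have "step_target D a \<in> verts D"
    using Cons.prems assms(1) by (cases a; cases "snd a") auto
  with Cons show ?case
    by (cases "p = []") (auto simp: successively_Cons neq_iff_opposite)
qed simp

lemma underlying_walk_imp_alternating_walk:
  assumes "underlying_walk D x p y" "successively (\<lambda>s t. snd s \<noteq> snd t) p" "p \<noteq> []"
  shows "alternating_walk D (x, snd (hd p)) p (y, opposite (snd (last p)))"
  using assms
proof (induction p arbitrary: x)
  case (Cons a p)
  then show ?case
    by (cases "p = []") (auto simp: successively_Cons neq_iff_opposite)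
qed simp

text \<open>Forward trails link out-copies to in-copies of distinct vertices. Three vertices suffice
  to link also the two copies of one vertex; conversely, a connecting walk can be chosen without
  repeated arcs.\<close>

lemma antistrong_iff_connected:
  assumes arcs: "\<And>e. e \<in> arcs D \<Longrightarrow> tail D e \<in> verts D \<and> head D e \<in> verts D"
    and three: "card (verts D) \<ge> 3"
  shows "antistrong D \<longleftrightarrow>
    (verts D \<times> UNIV) \<times> (verts D \<times> UNIV) \<subseteq> conn (arc_edge D ` arcs D)"
    (is "_ \<longleftrightarrow> _ \<subseteq> ?C")
proof
  assume as: "antistrong D"
  have *: "((x, Forward), (y, Backward)) \<in> ?C" if xy: "x \<in> verts D" "y \<in> verts D" "x \<noteq> y" for x y
  proof -
    obtain p where "forward_antidirected_trail D x p y"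
      using as xy unfolding antistrong_def by blast
    then have "alternating_walk D (x, Forward) p (y, Backward)"
      using underlying_walk_imp_alternating_walk[of D x p y]
      by (auto simp: forward_antidirected_trail_def antidirected_trail_def)
    then show ?thesis by (rule alternating_walk_imp_conn)
  qed
  have **: "((x, Forward), (y, Backward)) \<in> ?C" if xy: "x \<in> verts D" "y \<in> verts D" for x y
  proof (cases "x = y")
    case True
    have "\<not> verts D \<subseteq> {x}" using three card_mono[of "{x}" "verts D"] by auto
    then obtain z where z: "z \<in> verts D" "z \<noteq> x" by blast
    have "\<not> verts D \<subseteq> {x, z}"
      using three card_mono[of "{x, z}" "verts D"] by (auto simp: card_insert_if split: if_splits)
    then obtain w where w: "w \<in> verts D" "w \<noteq> x" "w \<noteq> z" by blast
    \<comment> \<open>The detour through the in-copy of \<open>w\<close> and the out-copy of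
      \<open>z\<close> uses only links between distinct vertices.\<close>
    have "((x, Forward), (w, Backward)) \<in> ?C" using * xy w by simp
    also have "((w, Backward), (z, Forward)) \<in> ?C" using *[of z w] z w by (simp add: conn_sym)
    also have "((z, Forward), (x, Backward)) \<in> ?C" using * xy z by simp
    finally show ?thesis using True by simp
  qed (rule *[OF xy])
  show "(verts D \<times> UNIV) \<times> (verts D \<times> UNIV) \<subseteq> ?C"
  proof (clarify)
    fix x d y d' assume xy: "x \<in> verts D" "y \<in> verts D"
    have "((x, d), (x, Backward)) \<in> ?C"
      using **[OF xy(1) xy(1)] by (cases d) simp_all
    moreover have "((x, Backward), (y, d')) \<in> ?C"
      using conn_sym[OF **[OF xy(2) xy(1)]] conn_trans[OF conn_sym[OF **[OF xy(1) xy(1)]] **[OF xy]]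
      by (cases d') simp_all
    ultimately show "((x, d), (y, d')) \<in> ?C" by (rule conn_trans)
  qed
next
  assume conn: "(verts D \<times> UNIV) \<times> (verts D \<times> UNIV) \<subseteq> ?C"
  have "\<exists>p. forward_antidirected_trail D x p y" if "x \<in> verts D" "y \<in> verts D" for x y
  proof -
    have "((x, Forward), (y, Backward)) \<in> ?C" using conn that by blast
    then obtain p where p: "alternating_walk D (x, Forward) p (y, Backward)" "distinct (map fst p)"
      using conn_imp_alternating_walk alternating_walk_distinct by metis
    moreover have "p \<noteq> []" using p(1) by auto
    ultimately show ?thesis
      using alternating_walk_imp_underlying_walk[OF arcs p(1) that(1)]
      by (auto simp: forward_antidirected_trail_def antidirected_trail_def)
  qed
  then show "antistrong D" using three by (auto simp: antistrong_def)
qed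

section \<open>The bipartite double cover\<close>

text \<open>The ends form an unordered pair, so an edge of a loopless graph has two lifts here, one
  for each of its orientations.\<close>

definition cover_edges :: "('v, 'e) multigraph \<Rightarrow> 'e \<Rightarrow> (('v \<times> direction) \<times> ('v \<times> direction)) set" where
  "cover_edges G e = {((u, Forward), (v, Backward)) | u v. ends G e = {u, v}}"

definition cover :: "('v, 'e) multigraph \<Rightarrow> 'e set \<Rightarrow> ('v \<times> direction) rel" where
  "cover G F = \<Union>(cover_edges G ` F)"

definition adj :: "('v, 'e) multigraph \<Rightarrow> 'e set \<Rightarrow> 'v rel" where
  "adj G F = {(u, v). \<exists>e\<in>F. ends G e = {u, v}}"

lemma cover_iff: "((u, d), (v, d')) \<in> cover G F \<longleftrightarrow> d = Forward \<and> d' = Backward \<and> (u, v) \<in> adj G F"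
  by (auto simp: cover_def cover_edges_def adj_def)

lemma adj_sym: "(u, v) \<in> adj G F \<Longrightarrow> (v, u) \<in> adj G F"
  by (auto simp: adj_def insert_commute)

lemma conn_cover_step:
  "(u, v) \<in> adj G F \<Longrightarrow> ((u, d), (v, opposite d)) \<in> conn (cover G F)"
  using conn_base[of "(u, Forward)" "(v, Backward)" "cover G F"]
    conn_sym[OF conn_base[of "(v, Forward)" "(u, Backward)" "cover G F"]]
  by (cases d) (auto dest: adj_sym simp: cover_iff)

text \<open>Exchanging the two copies of every vertex is an automorphism of the cover, since both
  lifts of each edge are present.\<close>

lemma conn_cover_opposite:
  assumes "(s, t) \<in> conn (cover G F)"
  shows "((fst s, opposite (snd s)), (fst t, opposite (snd t))) \<in> conn (cover G F)"
  using assms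
proof (induction rule: conn_induct)
  case (edge y z)
  have "((fst y, opposite (snd y)), (fst z, opposite (snd z))) \<in> conn (cover G F)"
    using edge(2) conn_cover_step[of "fst y" "fst z" G F "opposite (snd y)"]
    by (cases y; cases z) (auto simp: cover_iff)
  with edge.IH show ?case by (rule conn_trans)
next
  case (converse_edge y z)
  have "((fst z, opposite (snd z)), (fst y, opposite (snd y))) \<in> conn (cover G F)"
    using converse_edge(2) conn_cover_step[of "fst z" "fst y" G F "opposite (snd z)"]
    by (cases y; cases z) (auto simp: cover_iff)
  with converse_edge.IH show ?case by (meson conn_trans conn_sym)
qed simp

text \<open>Walks lift edge by edge from either copy of their start; the copy in which they end
  depends on the parity of the length.\<close>

lemma conn_cover_lift:
  assumes "(u, v) \<in> conn (adj G F)"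
  shows "\<exists>d'. ((u, d), (v, d')) \<in> conn (cover G F)"
  using assms
proof (induction rule: conn_induct)
  case (edge y z)
  then show ?case by (meson conn_cover_step conn_trans)
next
  case (converse_edge y z)
  then show ?case by (meson conn_cover_step conn_trans adj_sym)
qed (auto intro: conn_refl)

text \<open>
  A component of the graph lifts to one component of the double cover, or to two if it is
  bipartite: if the copies of \<open>x\<close> are not connected, the connection to \<open>(x, Forward)\<close> yields
  a 2-colouring.
\<close>

lemma card_comps_cover_part:
  assumes two: "\<And>e. e \<in> gedges G \<Longrightarrow> card (ends G e) = 2"
    and X: "X \<in> comps V (adj G F)"
  shows "card (comps (X \<times> UNIV) (cover G F)) \<le> 2"
    and "\<lbrakk>\<And>e. e \<in> gedges G \<Longrightarrow> ends G e \<subseteq> X \<Longrightarrow> e \<in> F; \<not> bipartite (induced G X)\<rbrakk> \<Longrightarrow>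
      card (comps (X \<times> UNIV) (cover G F)) \<le> 1"
proof -
  let ?C = "conn (cover G F)"
  obtain x where x: "X = conn (adj G F) `` {x}" using X by (auto simp: comps_eq_image)
  \<comment> \<open>Lifting joins \<open>(x, Forward)\<close> to one copy of \<open>v\<close>;
    exchanging the copies joins \<open>(x, Backward)\<close> to the other.\<close>
  have reach: "((x, Forward), (v, d)) \<in> ?C \<or> ((x, Backward), (v, d)) \<in> ?C" if "v \<in> X" for v d
  proof -
    have "(x, v) \<in> conn (adj G F)" using that x by simp
    then obtain d' where d': "((x, Forward), (v, d')) \<in> ?C"
      using conn_cover_lift by metis
    show ?thesis
      using d' conn_cover_opposite[OF d'] by (cases d; cases d') auto
  qed
  have sub: "comps (X \<times> UNIV) (cover G F) \<subseteq> {?C `` {(x, Forward)}, ?C `` {(x, Backward)}}"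
  proof
    fix K assume "K \<in> comps (X \<times> UNIV) (cover G F)"
    then obtain v d where "v \<in> X" "K = ?C `` {(v, d)}" by (auto simp: comps_eq_image)
    then show "K \<in> {?C `` {(x, Forward)}, ?C `` {(x, Backward)}}"
      using reach[of v d] unfolding conn_class_eq_iff[symmetric] by auto
  qed
  show "card (comps (X \<times> UNIV) (cover G F)) \<le> 2"
  proof -
    have "card (comps (X \<times> UNIV) (cover G F)) \<le> card {?C `` {(x, Forward)}, ?C `` {(x, Backward)}}"
      using sub by (intro card_mono) auto
    also have "\<dots> \<le> 2" by (simp add: card_insert_if)
    finally show ?thesis .
  qed
  show "card (comps (X \<times> UNIV) (cover G F)) \<le> 1"
    if F: "\<And>e. e \<in> gedges G \<Longrightarrow> ends G e \<subseteq> X \<Longrightarrow> e \<in> F" and nonbip: "\<not> bipartite (induced G X)"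
  proof -
    have "((x, Forward), (x, Backward)) \<in> ?C"
    proof (rule ccontr)
      assume sep: "((x, Forward), (x, Backward)) \<notin> ?C"
      let ?A = "{v \<in> X. ((x, Forward), (v, Forward)) \<in> ?C}"
      let ?B = "{v \<in> X. ((x, Forward), (v, Backward)) \<in> ?C}"
      have "?A \<inter> ?B = {}"
      proof (rule equals0I)
        fix v assume v: "v \<in> ?A \<inter> ?B"
        then have "((x, Backward), (v, Forward)) \<in> ?C"
          using conn_cover_opposite[of "(x, Forward)" "(v, Backward)" G F] by simp
        then show False using v sep by (auto intro: conn_trans dest: conn_sym)
      qed
      moreover have "?A \<union> ?B = X"
      proof -
        have "v \<in> ?A \<union> ?B" if v: "v \<in> X" for v
          using reach[OF v, of Forward] v
            conn_cover_opposite[of "(x, Backward)" "(v, Forward)" G F] by auto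
        then show ?thesis by blast
      qed
      moreover have "\<exists>a\<in>?A. \<exists>b\<in>?B. ends G e = {a, b}" if e: "e \<in> gedges G" "ends G e \<subseteq> X" for e
      proof -
        obtain u v where uv: "ends G e = {u, v}" using two[OF e(1)] by (auto simp: card_2_iff)
        have "(u, v) \<in> adj G F" using uv F[OF e] by (auto simp: adj_def)
        then have adj: "((u, d), (v, opposite d)) \<in> ?C" for d by (rule conn_cover_step)
        have "u \<in> ?A \<union> ?B" using uv e(2) \<open>?A \<union> ?B = X\<close> by blast
        then show ?thesis
        proof
          assume "u \<in> ?A"
          moreover from this have "v \<in> ?B"
            using uv e(2) adj[of Forward] by (auto intro: conn_trans)
          ultimately show ?thesis using uv by blast
        next
          assume "u \<in> ?B"
          moreover from this have "v \<in> ?A"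
            using uv e(2) adj[of Backward] by (auto intro: conn_trans)
          moreover have "ends G e = {v, u}" using uv by auto
          ultimately show ?thesis by blast
        qed
      qed
      ultimately have "bipartite (induced G X)"
        unfolding bipartite_def induced_def
      by - (rule exI[of _ ?A], rule exI[of _ ?B], simp)
      then show False using nonbip by blast
    qed
    then have "?C `` {(x, Forward)} = ?C `` {(x, Backward)}" by (simp add: conn_class_eq_iff)
    then have "comps (X \<times> UNIV) (cover G F) \<subseteq> {?C `` {(x, Forward)}}" using sub by simp
    then have "card (comps (X \<times> UNIV) (cover G F)) \<le> card {?C `` {(x, Forward)}}"
      by (intro card_mono) auto
    then show ?thesis by simp
  qed
qed

section \<open>Partitions of the graph and components of its double cover\<close>

context fin_loopless_multigraph
begin

lemma cover_subset: "F \<subseteq> gedges G \<Longrightarrow> cover G F \<subseteq> (gverts G \<times> UNIV) \<times> (gverts G \<times> UNIV)"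
  using ends_in_gverts by (fastforce simp: cover_def cover_edges_def)

lemma adj_subset: "F \<subseteq> gedges G \<Longrightarrow> adj G F \<subseteq> gverts G \<times> gverts G"
  using ends_in_gverts by (fastforce simp: adj_def)

lemma ends_nonempty: "e \<in> gedges G \<Longrightarrow> ends G e \<noteq> {}"
  using two_ends by fastforce

text \<open>Derives the Rado condition from the partition condition for the components of
  \<open>F\<close>. Each part is counted separately, and the edges outside \<open>F\<close> are
  split into those inside a part and those across.\<close>

lemma card_comps_cover_le:
  assumes F: "F \<subseteq> gedges G"
  defines "Q \<equiv> comps (gverts G) (adj G F)"
  shows "card (comps (gverts G \<times> UNIV) (cover G F)) + card (cross_edges G Q)
    \<le> card Q + card (bipartite_parts G Q) + card (gedges G - F)"
proof -
  let ?c = "\<lambda>X. card (comps (X \<times> UNIV) (cover G F))"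
  let ?inner = "\<lambda>X. {e \<in> gedges G - F. ends G e \<subseteq> X}"
  have part: "partition_on (gverts G) Q"
    unfolding Q_def by (rule partition_on_comps[OF adj_subset[OF F]])
  have finQ: "finite Q" unfolding Q_def using finite_gverts by simp
  have disj: "X = Y" if "X \<in> Q" "Y \<in> Q" "v \<in> X" "v \<in> Y" for X Y v
    using that partition_onD2[OF part] by (auto simp: disjoint_def)
  have fin_inner: "finite (?inner X)" for X using finite_gedges by simp
  \<comment> \<open>A nonbipartite part gives a single component if \<open>F\<close> contains all
    edges of \<open>G\<close> inside it; otherwise an edge missing from \<open>F\<close> pays for
    the possible second component.\<close>
  have local: "?c X \<le> 1 + (if bipartite (induced G X) then 1 else 0) + card (?inner X)"
    if X: "X \<in> Q" for X
  proof (cases "?inner X = {}")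
    case True
    then show ?thesis
      using card_comps_cover_part[OF two_ends X[unfolded Q_def]] by force
  next
    case False
    then have "card (?inner X) \<ge> 1" using fin_inner[of X] by (simp add: Suc_le_eq card_gt_0_iff)
    then show ?thesis
      using card_comps_cover_part(1)[OF two_ends X[unfolded Q_def]] by simp
  qed
  have "gverts G \<times> (UNIV :: direction set) = (\<Union>X\<in>Q. X \<times> UNIV)" using partition_onD1[OF part] by auto
  then have "comps (gverts G \<times> UNIV) (cover G F) = (\<Union>X\<in>Q. comps (X \<times> UNIV) (cover G F))"
    unfolding comps_eq_image by (simp only: image_UN)
  then have "card (comps (gverts G \<times> UNIV) (cover G F)) \<le> (\<Sum>X\<in>Q. ?c X)"
    using card_UN_le[OF finQ] by metis
  also have "\<dots> \<le> (\<Sum>X\<in>Q. 1 + (if bipartite (induced G X) then 1 else 0) + card (?inner X))"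
    using local by (rule sum_mono)
  also have "\<dots> = card Q + card (bipartite_parts G Q) + (\<Sum>X\<in>Q. card (?inner X))"
    unfolding sum.distrib using finQ by (simp add: bipartite_parts_def sum.If_cases Int_def)
  also have "(\<Sum>X\<in>Q. card (?inner X)) = card (\<Union>X\<in>Q. ?inner X)"
  proof (rule card_UN_disjoint[symmetric, OF finQ])
    show "\<forall>X\<in>Q. \<forall>Y\<in>Q. X \<noteq> Y \<longrightarrow> ?inner X \<inter> ?inner Y = {}"
      using ends_nonempty disj by blast
  qed (use fin_inner in blast)
  finally have "card (comps (gverts G \<times> UNIV) (cover G F))
      \<le> card Q + card (bipartite_parts G Q) + card (\<Union>X\<in>Q. ?inner X)" .
  moreover have "card (\<Union>X\<in>Q. ?inner X) + card (cross_edges G Q) \<le> card (gedges G - F)"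
  proof -
    have cross: "cross_edges G Q \<subseteq> gedges G - F"
    proof
      fix e assume "e \<in> cross_edges G Q"
      then obtain X Y x y where e: "e \<in> gedges G" "X \<in> Q" "Y \<in> Q" "X \<noteq> Y" "x \<in> X" "y \<in> Y"
        "ends G e = {x, y}" unfolding cross_edges_def by blast
      have "e \<notin> F"
      proof
        assume "e \<in> F"
        then have "(x, y) \<in> conn (adj G F)" using e(7) by (auto simp: adj_def intro: conn_base)
        then have "y \<in> X" using e(2,5) by (auto simp: Q_def comps_eq_image intro: conn_trans)
        then show False using e disj by blast
      qed
      then show "e \<in> gedges G - F" using e(1) by blast
    qed
    have "(\<Union>X\<in>Q. ?inner X) \<inter> cross_edges G Q = {}"
    proof (rule equals0I)
      fix e assume e: "e \<in> (\<Union>X\<in>Q. ?inner X) \<inter> cross_edges G Q"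
      then obtain X Y x y where XY: "X \<in> Q" "Y \<in> Q" "X \<noteq> Y" "x \<in> X" "y \<in> Y" "ends G e = {x, y}"
        unfolding cross_edges_def by blast
      obtain Z where "Z \<in> Q" "ends G e \<subseteq> Z" using e by blast
      then show False using XY disj[of X Z x] disj[of Y Z y] by simp
    qed
    moreover have "finite (\<Union>X\<in>Q. ?inner X)" using finQ fin_inner by blast
    moreover have "finite (cross_edges G Q)"
      using cross finite_gedges by (meson finite_Diff finite_subset)
    ultimately have "card (\<Union>X\<in>Q. ?inner X) + card (cross_edges G Q)
        = card ((\<Union>X\<in>Q. ?inner X) \<union> cross_edges G Q)"
      by (simp only: card_Un_disjoint)
    also have "\<dots> \<le> card (gedges G - F)"
      using cross finite_gedges by (intro card_mono) auto
    finally show ?thesis .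
  qed
  ultimately show ?thesis by linarith
qed

text \<open>Without cross edges the cover splits along the parts, and over a bipartite part it
  splits once more. Labels constant along the edges of the cover tell these pieces apart.\<close>

lemma card_comps_cover_ge:
  assumes part: "partition_on (gverts G) Q"
  shows "card Q + card (bipartite_parts G Q)
    \<le> card (comps (gverts G \<times> UNIV) (cover G (gedges G - cross_edges G Q)))"
proof -
  let ?V = "gverts G" and ?Q2 = "bipartite_parts G Q"
  have disj: "X = Y" if "X \<in> Q" "Y \<in> Q" "v \<in> X" "v \<in> Y" for X Y v
    using that partition_onD2[OF part] by (auto simp: disjoint_def)
  have "\<exists>P. \<forall>v\<in>?V. P v \<in> Q \<and> v \<in> P v"
    using partition_onD1[OF part] by (intro bchoice) blast
  then obtain P where P: "\<And>v. v \<in> ?V \<Longrightarrow> P v \<in> Q" "\<And>v. v \<in> ?V \<Longrightarrow> v \<in> P v" by blast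
  \<comment> \<open>Replacing the second colour class by the complement of the first leaves one set
    to choose per part.\<close>
  have "\<forall>X\<in>?Q2. \<exists>A. \<forall>e\<in>gedges G. ends G e \<subseteq> X \<longrightarrow> (\<exists>a\<in>A. \<exists>b\<in>- A. ends G e = {a, b})"
  proof
    fix X assume "X \<in> ?Q2"
    then obtain A B where AB: "A \<inter> B = {}"
      "\<forall>e\<in>gedges G. ends G e \<subseteq> X \<longrightarrow> (\<exists>a\<in>A. \<exists>b\<in>B. ends G e = {a, b})"
      unfolding bipartite_parts_def bipartite_def induced_def by auto
    then have "B \<subseteq> - A" by blast
    with AB(2) show "\<exists>A. \<forall>e\<in>gedges G. ends G e \<subseteq> X \<longrightarrow> (\<exists>a\<in>A. \<exists>b\<in>- A. ends G e = {a, b})"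
      by (meson subsetD)
  qed
  from bchoice[OF this] obtain A where "\<forall>X\<in>?Q2. \<forall>e\<in>gedges G. ends G e \<subseteq> X \<longrightarrow>
      (\<exists>a\<in>A X. \<exists>b\<in>- A X. ends G e = {a, b})" ..
  then have A: "\<exists>a\<in>A X. \<exists>b\<in>- A X. ends G e = {a, b}"
    if "X \<in> ?Q2" "e \<in> gedges G" "ends G e \<subseteq> X" for X e
    using that by simp
  \<comment> \<open>In a bipartite part the flag compares colour with copy. Along an edge of the
    cover both change, so the flag is preserved; in other parts it is always
    \<open>True\<close>.\<close>
  define l where "l = (\<lambda>(v, d). (P v, P v \<in> ?Q2 \<longrightarrow> (v \<in> A (P v) \<longleftrightarrow> d = Forward)))"
  have "l s = l t" if st: "(s, t) \<in> cover G (gedges G - cross_edges G Q)" for s t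
  proof -
    obtain u v e where e: "s = (u, Forward)" "t = (v, Backward)" "e \<in> gedges G"
      "e \<notin> cross_edges G Q" "ends G e = {u, v}"
      using st by (auto simp: cover_def cover_edges_def)
    have uv: "u \<in> ?V" "v \<in> ?V" using ends_in_gverts[OF e(3)] e(5) by auto
    have eq: "P u = P v"
      using e(3-5) P[OF uv(1)] P[OF uv(2)] unfolding cross_edges_def by blast
    have "u \<in> A (P v) \<longleftrightarrow> v \<notin> A (P v)" if "P v \<in> ?Q2"
      using A[OF that e(3)] e(5) P(2)[OF uv(1)] P(2)[OF uv(2)] eq by (auto simp: doubleton_eq_iff)
    then show ?thesis using e eq by (auto simp: l_def)
  qed
  then have "card (l ` (?V \<times> UNIV)) \<le> card (comps (?V \<times> UNIV) (cover G (gedges G - cross_edges G Q)))"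
    using finite_gverts by (intro card_comps_ge_image) auto
  moreover have "Q \<times> {True} \<union> ?Q2 \<times> {False} \<subseteq> l ` (?V \<times> UNIV)"
  proof -
    have "(X, c) \<in> l ` (?V \<times> UNIV)" if X: "X \<in> Q" and c: "c \<or> X \<in> ?Q2" for X c
    proof -
      obtain v where v: "v \<in> X" using X partition_onD3[OF part] by fastforce
      then have "v \<in> ?V" using X partition_onD1[OF part] by blast
      moreover from this have "P v = X" using P disj X v by blast
      \<comment> \<open>Over a bipartite part, switching to the other copy of \<open>v\<close> flips
        the flag, so either value of \<open>c\<close> can be realised.\<close>
      ultimately have "(X, c) = l (v, if (v \<in> A X) = c then Forward else Backward)"
        using c by (auto simp: l_def)
      then show ?thesis using \<open>v \<in> ?V\<close> by blast
    qed
    moreover have "?Q2 \<subseteq> Q" by (auto simp: bipartite_parts_def)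
    ultimately show ?thesis by blast
  qed
  then have "card (Q \<times> {True} \<union> ?Q2 \<times> {False}) \<le> card (l ` (?V \<times> UNIV))"
    using finite_gverts by (intro card_mono) auto
  moreover have "card (Q \<times> {True} \<union> ?Q2 \<times> {False}) = card Q + card ?Q2"
  proof -
    have "finite Q" using part finite_gverts finite_elements by blast
    moreover have "finite ?Q2" using \<open>finite Q\<close> by (simp add: bipartite_parts_def)
    ultimately show ?thesis by (subst card_Un_disjoint) (auto simp: card_cartesian_product)
  qed
  ultimately show ?thesis by linarith
qed

section \<open>Orientations as choices of one lift per edge\<close>

lemma orientation_arc_edge:
  assumes "orientation_of D G" "e \<in> gedges G"
  shows "arc_edge D e \<in> cover_edges G e"
  using assms by (auto simp: orientation_of_def arc_edge_def cover_edges_def)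

text \<open>The representation of \<open>D\<close> is connected, so deleting the cross arcs leaves
  at most one component more than there are cross edges. What remains lies in the cover of the other
  edges, whose components are bounded from below.\<close>

lemma antistrong_imp_partition_condition:
  assumes D: "orientation_of D G" and "antistrong D" and part: "partition_on (gverts G) Q"
  shows "card Q + card (bipartite_parts G Q) \<le> card (cross_edges G Q) + 1"
proof -
  let ?W = "gverts G \<times> (UNIV :: direction set)"
  let ?F = "gedges G - cross_edges G Q"
  have finW: "finite ?W" using finite_gverts by simp
  have cross: "cross_edges G Q \<subseteq> gedges G" by (auto simp: cross_edges_def)
  have verts: "verts D = gverts G" "arcs D = gedges G" using D by (auto simp: orientation_of_def)
  have arcs: "tail D e \<in> verts D \<and> head D e \<in> verts D" if "e \<in> arcs D" for e
    using D that ends_in_gverts unfolding orientation_of_def by blast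
  have sub: "arc_edge D ` E' \<subseteq> ?W \<times> ?W" if "E' \<subseteq> gedges G" for E'
    using that arcs verts by (auto simp: arc_edge_def)
  have "?W \<times> ?W \<subseteq> conn (arc_edge D ` gedges G)"
    using antistrong_iff_connected[of D, OF arcs] \<open>antistrong D\<close> verts
    by (simp add: antistrong_def)
  then have "card (comps ?W (arc_edge D ` gedges G)) \<le> 1"
    using card_comps_le_1_iff[OF finW] by blast
  moreover have "card (comps ?W (arc_edge D ` ?F))
      \<le> card (comps ?W (arc_edge D ` gedges G)) + card (arc_edge D ` cross_edges G Q)"
  proof -
    have "arc_edge D ` ?F \<union> arc_edge D ` cross_edges G Q = arc_edge D ` gedges G"
      using cross by blast
    then show ?thesis
      using card_comps_Un_bounds[OF finW _ sub[OF cross], of "arc_edge D ` ?F"]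
        finite_subset[OF cross finite_gedges] by simp
  qed
  moreover have "card (arc_edge D ` cross_edges G Q) \<le> card (cross_edges G Q)"
    using finite_subset[OF cross finite_gedges] by (rule card_image_le)
  moreover have "card (comps ?W (cover G ?F)) \<le> card (comps ?W (arc_edge D ` ?F))"
    using orientation_arc_edge[OF D]
    by (intro card_comps_antimono[OF finW _ cover_subset]) (auto simp: cover_def)
  ultimately show ?thesis using card_comps_cover_ge[OF part] by linarith
qed

text \<open>A graph with at most two vertices is bipartite, and then the partition with a single
  part would give \<open>1 + 1 \<le> 0 + 1\<close>.\<close>

lemma partition_condition_imp_three_vertices:
  assumes "\<And>Q. partition_on (gverts G) Q \<Longrightarrow>
      card Q + card (bipartite_parts G Q) \<le> card (cross_edges G Q) + 1"
  shows "card (gverts G) \<ge> 3"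
proof (rule ccontr)
  assume small: "\<not> card (gverts G) \<ge> 3"
  obtain x where x: "x \<in> gverts G" using gverts_nonempty by blast
  have "bipartite (induced G (gverts G))"
    unfolding bipartite_def
  proof (rule exI[of _ "{x}"], rule exI[of _ "gverts G - {x}"], intro conjI ballI)
    show "{x} \<union> (gverts G - {x}) = gverts (induced G (gverts G))"
      using x by (auto simp: induced_def)
    show "{x} \<inter> (gverts G - {x}) = {}" by blast
    fix e assume "e \<in> gedges (induced G (gverts G))"
    then have e: "e \<in> gedges G" by (simp add: induced_def)
    \<comment> \<open>The two ends of an edge already exhaust a vertex set of size at most
      two.\<close>
    have spanning: "ends G e = gverts G"
      using card_seteq[OF finite_gverts ends_in_gverts[OF e]] two_ends[OF e] small by simp
    obtain u v where uv: "ends G e = {u, v}" "u \<noteq> v"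
      using two_ends[OF e] unfolding card_2_iff by blast
    then have "x = u \<or> x = v" using x spanning by blast
    then have "ends G e = {x, if x = u then v else u}" using uv by auto
    moreover have "(if x = u then v else u) \<in> gverts G - {x}"
      using uv spanning by auto
    ultimately have "\<exists>y\<in>gverts G - {x}. ends G e = {x, y}" by blast
    then show "\<exists>a\<in>{x}. \<exists>b\<in>gverts G - {x}. ends (induced G (gverts G)) e = {a, b}"
      by (simp add: induced_def)
  qed
  then have "bipartite_parts G {gverts G} = {gverts G}"
    by (auto simp: bipartite_parts_def)
  moreover have "cross_edges G {gverts G} = {}" by (auto simp: cross_edges_def)
  moreover have "partition_on (gverts G) {gverts G}"
    using gverts_nonempty by (rule partition_on_space)
  ultimately show False using assms[of "{gverts G}"] by simp
qed

text \<open>Rado's theorem is applied to the lifts of the edges, with the negated number of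
  components as \<open>r\<close>. The target \<open>k = - 1\<close> means that the chosen lifts form
  a connected graph.\<close>

lemma partition_condition_imp_antistrong_orientation:
  assumes cond: "\<And>Q. partition_on (gverts G) Q \<Longrightarrow>
      card Q + card (bipartite_parts G Q) \<le> card (cross_edges G Q) + 1"
  shows "\<exists>D. orientation_of D G \<and> antistrong D"
proof -
  let ?W = "gverts G \<times> (UNIV :: direction set)"
  let ?r = "\<lambda>X. - int (card (comps ?W X))"
  have finW: "finite ?W" using finite_gverts by simp
  have "\<exists>f. (\<forall>e\<in>gedges G. f e \<in> cover_edges G e) \<and> - 1 \<le> ?r (f ` gedges G)"
  proof (rule rado_defect[where S = "?W \<times> ?W"])
    show "?r X \<le> ?r Y" if "X \<subseteq> Y" "Y \<subseteq> ?W \<times> ?W" for X Y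
      using card_comps_antimono[OF finW that] by simp
    show "?r (X \<union> Y) + ?r (X \<inter> Y) \<le> ?r X + ?r Y" if "X \<subseteq> ?W \<times> ?W" "Y \<subseteq> ?W \<times> ?W" for X Y
      using card_comps_supermodular[OF finW that] by linarith
    show "finite (cover_edges G e) \<and> cover_edges G e \<noteq> {} \<and> cover_edges G e \<subseteq> ?W \<times> ?W"
      if e: "e \<in> gedges G" for e
    proof -
      have "cover_edges G e \<subseteq> ?W \<times> ?W"
        using cover_subset[of "{e}"] e by (simp add: cover_def)
      moreover from this have "finite (cover_edges G e)"
        using finW by (meson finite_SigmaI finite_subset)
      moreover have "cover_edges G e \<noteq> {}"
        using two_ends[OF e] by (auto simp: card_2_iff cover_edges_def)
      ultimately show ?thesis by blast
    qed
    \<comment> \<open>The partition condition is used only for the components of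
      \<open>F\<close>.\<close>
    show "- 1 \<le> int (card (gedges G - F)) + ?r (\<Union>(cover_edges G ` F))" if "F \<subseteq> gedges G" for F
      using card_comps_cover_le[OF that] cond[OF partition_on_comps[OF adj_subset[OF that]]]
      unfolding cover_def by linarith
  qed (rule finite_gedges)
  then obtain f where f: "\<And>e. e \<in> gedges G \<Longrightarrow> f e \<in> cover_edges G e"
    and "card (comps ?W (f ` gedges G)) \<le> 1" by auto
  then have conn: "?W \<times> ?W \<subseteq> conn (f ` gedges G)"
    using card_comps_le_1_iff[OF finW] by blast
  \<comment> \<open>The chosen lift of an edge has the tail as its out-copy and the head as its
    in-copy.\<close>
  define D where "D = \<lparr>verts = gverts G, arcs = gedges G,
    tail = \<lambda>e. fst (fst (f e)), head = \<lambda>e. fst (snd (f e))\<rparr>"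
  have D: "verts D = gverts G" "arcs D = gedges G" by (simp_all add: D_def)
  have f_eq: "f e = arc_edge D e" and D_ends: "{tail D e, head D e} = ends G e"
    if e: "e \<in> gedges G" for e
  proof -
    obtain u v where "f e = ((u, Forward), (v, Backward))" "ends G e = {u, v}"
      using f[OF e] unfolding cover_edges_def by blast
    then show "f e = arc_edge D e" "{tail D e, head D e} = ends G e"
      by (simp_all add: arc_edge_def D_def)
  qed
  have "orientation_of D G" using D D_ends by (simp add: orientation_of_def)
  moreover have "antistrong D"
  proof (subst antistrong_iff_connected)
    show "tail D e \<in> verts D \<and> head D e \<in> verts D" if "e \<in> arcs D" for e
      using D_ends[of e] ends_in_gverts[of e] that unfolding D by blast
    show "3 \<le> card (verts D)"
      unfolding D by (rule partition_condition_imp_three_vertices) (rule cond)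
    have "f ` gedges G = arc_edge D ` gedges G"
      by (rule image_cong) (simp_all add: f_eq)
    then show "(verts D \<times> UNIV) \<times> (verts D \<times> UNIV) \<subseteq> conn (arc_edge D ` arcs D)"
      using conn unfolding D by simp
  qed
  ultimately show ?thesis by blast
qed

end

theorem theorem6p8:
  fixes G :: "('v, 'e) multigraph"
  assumes "fin_loopless_multigraph G"
  shows "(\<exists>D. orientation_of D G \<and> antistrong D) \<longleftrightarrow>
    (\<forall>Q. partition_on (gverts G) Q \<longrightarrow>
      int (card (cross_edges G Q)) \<ge> int (card Q) - 1 + int (card (bipartite_parts G Q)))"
proof -
  interpret fin_loopless_multigraph G by (rule assms)
  \<comment> \<open>The inequality is first treated in additive form over the naturals, which avoids
    truncated subtraction.\<close>
  have "(\<exists>D. orientation_of D G \<and> antistrong D) \<longleftrightarrow>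
    (\<forall>Q. partition_on (gverts G) Q \<longrightarrow>
      card Q + card (bipartite_parts G Q) \<le> card (cross_edges G Q) + 1)"
  proof
    assume "\<exists>D. orientation_of D G \<and> antistrong D"
    then show "\<forall>Q. partition_on (gverts G) Q \<longrightarrow>
        card Q + card (bipartite_parts G Q) \<le> card (cross_edges G Q) + 1"
      using antistrong_imp_partition_condition by blast
  qed (rule partition_condition_imp_antistrong_orientation, blast)
  moreover have "card Q + card (bipartite_parts G Q) \<le> card (cross_edges G Q) + 1 \<longleftrightarrow>
      int (card (cross_edges G Q)) \<ge> int (card Q) - 1 + int (card (bipartite_parts G Q))" for Q
    by linarith
  ultimately show ?thesis by simp
qed

end
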